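(* Let $p$ be an odd prime. Then $$\sum_{k=0}^{p-3}E_kE_{p-3-k}\equiv 2\left(\frac{-1}{p}\right)E_{p-3}\pmod p.$$ Moreover, for every integer $n\ge 0$, $$\sum_{k=0}^{p-1+2n}E_kE_{p-1+2n-k}\equiv s(n)+\delta(p,n)\pmod p,$$ where $$s(n)=\sum_{k=0}^{n}E_{2k}E_{2n-2k}$$ and $\delta(p,n)=1$ if $n>0$ and $p-1\mid 2n$, while $\delta(p,n)=0$ otherwise.
   Context: The Euler numbers $E_n$ ($n=0,1,2,\ldots$) are the integers defined by $E_0=1$ and $\sum_{0\le k\le n,\ 2\mid k}\binom{n}{k}E_{n-k}=0$ for all $n\ge 1$; equivalently $\frac{2e^x}{e^{2x}+1}=\sum_{n\ge0}E_n\frac{x^n}{n!}$. In particular $E_{2n+1}=0$ for all $n\ge 0$. $\left(\frac{-1}{p}\right)$ denotes the Legendre/Jacobi symbol, i.e. $(-1)^{(p-1)/2}$. *)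

theory Defs
  imports "HOL-Number_Theory.Number_Theory"
begin

text \<open>
  The Euler (secant) numbers, with signs: 1, 0, -1, 0, 5, 0, -61, ...
  The recursive equation is the defining recurrence
  \<open>\<Sum>k\<in>{k. k \<le> n \<and> even k}. (n choose k) * E (n - k) = 0\<close> for \<open>n \<ge> 1\<close>,
  solved for its \<open>k = 0\<close> term; see \<open>euler_number_recurrence\<close> and
  \<open>euler_number_unique\<close> below.
\<close>

fun euler_number :: "nat \<Rightarrow> int" where
  "euler_number n =
     (if n = 0 then 1
      else - (\<Sum>k\<in>{k\<in>{1..n}. even k}. int (n choose k) * euler_number (n - k)))"

declare euler_number.simps [simp del]

lemma euler_number_0: "euler_number 0 = 1"
  by (simp add: euler_number.simps)

lemma sum_even_index_split:
  fixes f :: "nat \<Rightarrow> int"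
  shows "(\<Sum>k | k \<le> n \<and> even k. f k) = f 0 + (\<Sum>k\<in>{k\<in>{1..n}. even k}. f k)"
proof -
  have "{k. k \<le> n \<and> even k} = insert 0 {k\<in>{1..n}. even k}"
    by (auto simp: Suc_le_eq)
  moreover have "finite {k\<in>{1..n}. even k}" "0 \<notin> {k\<in>{1..n}. even k}"
    by auto
  ultimately show ?thesis
    by (simp only: sum.insert not_False_eq_True)
qed

lemma euler_number_recurrence:
  assumes "n \<ge> 1"
  shows "(\<Sum>k | k \<le> n \<and> even k. int (n choose k) * euler_number (n - k)) = 0"
  using assms by (simp add: sum_even_index_split euler_number.simps [of n])

lemma euler_number_unique:
  fixes F :: "nat \<Rightarrow> int"
  assumes F0: "F 0 = 1"
    and rec: "\<And>n. n \<ge> 1 \<Longrightarrow> (\<Sum>k | k \<le> n \<and> even k. int (n choose k) * F (n - k)) = 0"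
  shows "F n = euler_number n"
proof (induction n rule: less_induct)
  case (less n)
  show ?case
  proof (cases "n = 0")
    case True
    then show ?thesis by (simp add: F0 euler_number_0)
  next
    case False
    have "F n + (\<Sum>k\<in>{k\<in>{1..n}. even k}. int (n choose k) * F (n - k)) = 0"
      using rec [of n] False by (simp add: sum_even_index_split)
    moreover have "(\<Sum>k\<in>{k\<in>{1..n}. even k}. int (n choose k) * F (n - k)) =
        (\<Sum>k\<in>{k\<in>{1..n}. even k}. int (n choose k) * euler_number (n - k))"
      using less.IH False by (intro sum.cong) auto
    ultimately show ?thesis
      using False by (simp add: euler_number.simps [of n])
  qed
qed

definition euler_delta :: "nat \<Rightarrow> nat \<Rightarrow> int" where
  "euler_delta p n = (if n > 0 \<and> (p - 1) dvd 2 * n then 1 else 0)"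

definition euler_s :: "nat \<Rightarrow> int" where
  "euler_s n = (\<Sum>k=0..n. euler_number (2 * k) * euler_number (2 * n - 2 * k))"

end

theory Submission
  imports Defs "HOL-Computational_Algebra.Formal_Power_Series"
begin

text \<open>
  The exponential generating function of the Euler numbers is inverted by
  \<open>(exp x + exp (-x)) / 2\<close>, so an alternating sum of exponentials telescopes and gives
  \<open>E\<^sub>n \<equiv> \<Sum>j<p. (-1)^j (2j+1)^n (mod p)\<close>. Call \<open>e n\<close> this sum
  without its term \<open>j = (p-1)/2\<close>, whose base is \<open>p\<close>. The sequence \<open>e\<close> is periodic
  modulo \<open>p\<close> with period \<open>p - 1\<close>, agrees with \<open>E\<close> except at \<open>0\<close>, where
  \<open>E\<^sub>0 \<equiv> e 0 + (-1/p)\<close>, and since its Fourier coefficients are \<open>\<plusminus>1\<close>,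
  its cyclic convolution square is the indicator of \<open>p - 1 dvd n\<close>. Both congruences follow by
  splitting the convolution into full periods.
\<close>

section \<open>Euler numbers as alternating power sums\<close>

lemma euler_number_odd: "odd n \<Longrightarrow> euler_number n = 0"
proof (induction n rule: less_induct)
  case (less n)
  have "(\<Sum>k\<in>{k\<in>{1..n}. even k}. int (n choose k) * euler_number (n - k)) = 0"
    using less by (intro sum.neutral) auto
  then show ?case
    by (subst euler_number.simps) (use less.prems in \<open>auto elim: oddE\<close>)
qed

text \<open>This is the power series of sech; rational coefficients leave room for the division by
  factorials.\<close>

definition euler_egf :: "rat fps" where
  "euler_egf = Abs_fps (\<lambda>n. of_int (euler_number n) / fact n)"

lemma fps_nth_euler_egf_mult_exp:
  "fps_nth (euler_egf * fps_exp c) n =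
     (\<Sum>k\<le>n. of_nat (n choose k) * of_int (euler_number (n - k)) * c ^ k) / fact n"
proof -
  \<comment> \<open>Commuting the product first puts \<open>k\<close> on the exponential and
    \<open>n - k\<close> on the Euler number, the indexing of the defining recurrence.\<close>
  have "fps_nth (euler_egf * fps_exp c) n = fps_nth (fps_exp c * euler_egf) n"
    by (simp add: mult.commute)
  also have "\<dots> = (\<Sum>k\<le>n. c ^ k / fact k * (of_int (euler_number (n - k)) / fact (n - k)))"
    by (simp add: fps_mult_nth euler_egf_def atMost_atLeast0)
  also have "\<dots> = (\<Sum>k\<le>n. of_nat (n choose k) * of_int (euler_number (n - k)) * c ^ k / fact n)"
    by (intro sum.cong) (auto simp: binomial_fact field_simps)
  finally show ?thesis by (simp add: sum_divide_distrib)
qed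

text \<open>Adding the expansions for \<open>c = 1\<close> and \<open>c = -1\<close> cancels odd
  \<open>k\<close> and doubles even \<open>k\<close>, so each coefficient with \<open>n > 0\<close>
  is a multiple of the defining recurrence.\<close>

lemma euler_egf_mult_cosh: "euler_egf * (fps_exp 1 + fps_exp (-1)) = 2"
proof (rule fps_ext)
  fix n :: nat
  have "fps_nth (euler_egf * (fps_exp 1 + fps_exp (-1))) n =
     (\<Sum>k\<le>n. of_nat (n choose k) * of_int (euler_number (n - k)) * (1 + (-1) ^ k)) / fact n"
    unfolding distrib_left fps_add_nth fps_nth_euler_egf_mult_exp
    by (simp add: add_divide_distrib sum.distrib algebra_simps)
  also have "(\<Sum>k\<le>n. of_nat (n choose k) * of_int (euler_number (n - k)) * (1 + (-1) ^ k)) =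
     (\<Sum>k | k \<le> n \<and> even k. 2 * rat_of_int (int (n choose k) * euler_number (n - k)))"
    by (intro sum.mono_neutral_cong_right) auto
  also have "\<dots> = 2 * of_int (\<Sum>k | k \<le> n \<and> even k. int (n choose k) * euler_number (n - k))"
    by (simp add: sum_distrib_left)
  also have "\<dots> = (if n = 0 then 2 else 0)"
  proof (cases "n = 0")
    case True
    then have "{k. k \<le> n \<and> even k} = {0}" by auto
    then show ?thesis using True by (simp add: euler_number_0)
  next
    case False
    then show ?thesis using euler_number_recurrence [of n] by simp
  qed
  finally show "fps_nth (euler_egf * (fps_exp 1 + fps_exp (-1))) n = fps_nth 2 n"
    by (simp add: fps_numeral_nth)
qed

text \<open>Compares coefficients in sech(x) (1 + exp(2mx)) = 2 * (alternating sum of exp((2j+1)x)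
  over j < m). The telescoped sum ends with the sign \<open>- (-1) ^ m\<close>, which is a plus
  because \<open>m\<close> is odd.\<close>

lemma euler_number_binomial_sum:
  assumes "odd m"
  shows "euler_number n + (\<Sum>k\<le>n. int (n choose k) * euler_number (n - k) * (2 * int m) ^ k) =
    2 * (\<Sum>j<m. (-1) ^ j * (2 * int j + 1) ^ n)"
proof -
  \<comment> \<open>Multiplying exp((2l+1)x) by exp(x) + exp(-x) gives exp(2lx) + exp((2l+2)x); the
    alternating signs cancel neighbouring terms.\<close>
  have tele: "(fps_exp 1 + fps_exp (-1)) * (\<Sum>j<l. (-1) ^ j * fps_exp (of_nat (2 * j + 1))) =
      1 - (-1) ^ l * fps_exp (of_nat (2 * l) :: rat)" for l
  proof (induction l)
    case (Suc l)
    have "(fps_exp 1 + fps_exp (-1)) * fps_exp (of_nat (2 * l + 1)) =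
        fps_exp (of_nat (2 * l)) + fps_exp (of_nat (2 * Suc l) :: rat)"
      by (simp add: distrib_right fps_exp_add_mult [symmetric] add_ac)
    then show ?case
      using Suc by (simp add: algebra_simps)
  qed simp
  have "euler_egf + euler_egf * fps_exp (of_nat (2 * m)) =
      euler_egf * (1 - (-1) ^ m * fps_exp (of_nat (2 * m)))"
    using assms by (simp add: algebra_simps)
  also have "\<dots> = 2 * (\<Sum>j<m. (-1) ^ j * fps_exp (of_nat (2 * j + 1)))"
    unfolding tele [symmetric] mult.assoc [symmetric] euler_egf_mult_cosh ..
  finally have egf_eq: "euler_egf + euler_egf * fps_exp (of_nat (2 * m)) =
      2 * (\<Sum>j<m. (-1) ^ j * fps_exp (of_nat (2 * j + 1)))" .
  \<comment> \<open>On the left \<open>(-1) ^ j\<close> is a power series, on the right a rational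
    number.\<close>
  have sgn: "fps_nth ((-1) ^ j * F) n = (-1) ^ j * fps_nth F n" for j and F :: "rat fps"
    by (cases "even j") auto
  have two: "fps_nth (2 * F) n = 2 * fps_nth F n" for F :: "rat fps"
    by (simp only: mult_2 fps_add_nth)
  have "rat_of_int (euler_number n + (\<Sum>k\<le>n. int (n choose k) * euler_number (n - k) * (2 * int m) ^ k)) / fact n =
      fps_nth (euler_egf + euler_egf * fps_exp (of_nat (2 * m))) n"
    unfolding fps_add_nth fps_nth_euler_egf_mult_exp by (simp add: euler_egf_def add_divide_distrib)
  also have "\<dots> = 2 * (\<Sum>j<m. (-1) ^ j * (of_nat (2 * j + 1) ^ n / fact n))"
    unfolding egf_eq two fps_sum_nth sgn by simp
  also have "\<dots> = of_int (2 * (\<Sum>j<m. (-1) ^ j * (2 * int j + 1) ^ n)) / fact n"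
    by (simp add: sum_divide_distrib sum_distrib_left add.commute)
  finally have "rat_of_int (euler_number n + (\<Sum>k\<le>n. int (n choose k) * euler_number (n - k) * (2 * int m) ^ k)) =
      of_int (2 * (\<Sum>j<m. (-1) ^ j * (2 * int j + 1) ^ n))"
    by (subst (asm) divide_cancel_right) (simp only: fact_nonzero simp_thms)
  then show ?thesis by (simp only: of_int_eq_iff)
qed

text \<open>Modulo \<open>m\<close> only the term \<open>k = 0\<close> of the binomial sum survives,
  so twice the Euler number is congruent to twice the power sum; 2 is a unit since \<open>m\<close>
  is odd.\<close>

lemma euler_number_cong_power_sum:
  assumes "odd m"
  shows "[euler_number n = (\<Sum>j<m. (-1) ^ j * (2 * int j + 1) ^ n)] (mod int m)"
proof -
  define P where "P = (\<Sum>j<m. (-1) ^ j * (2 * int j + 1) ^ n)"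
  define T where "T = (\<Sum>k\<in>{1..n}. int (n choose k) * euler_number (n - k) * (2 * int m) ^ k)"
  have "(\<Sum>k\<le>n. int (n choose k) * euler_number (n - k) * (2 * int m) ^ k) = euler_number n + T"
    by (simp add: T_def atMost_atLeast0 sum.atLeast_Suc_atMost)
  with euler_number_binomial_sum [OF assms, of n]
  have "euler_number n + (euler_number n + T) = 2 * P"
    unfolding P_def by (simp only:)
  then have "2 * (euler_number n - P) = - T" by simp
  moreover have "int m dvd T"
    unfolding T_def by (intro dvd_sum dvd_mult) (auto intro: dvd_trans [OF _ dvd_power])
  ultimately have "int m dvd 2 * (euler_number n - P)"
    by (simp only: dvd_minus_iff)
  moreover have "coprime (int m) 2"
    using assms by simp
  ultimately show ?thesis
    unfolding cong_iff_dvd_diff P_def using coprime_dvd_mult_right_iff by blast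
qed

section \<open>The periodic part of the Euler numbers\<close>

text \<open>For an odd prime \<open>p\<close> every remaining base is a unit modulo
  \<open>p\<close>, so Fermat's theorem applies term by term.\<close>

definition periodic_euler :: "nat \<Rightarrow> nat \<Rightarrow> int" where
  "periodic_euler p n = (\<Sum>j\<in>{..<p} - {(p - 1) div 2}. (-1) ^ j * (2 * int j + 1) ^ n)"

section \<open>Odd residues, Fermat's theorem and power sums modulo an odd prime\<close>

context
  fixes p :: nat
  assumes p: "prime p" "odd p"
begin

lemma odd_prime_ge_3: "p \<ge> 3"
  using p prime_ge_2_nat [of p] by (cases "p = 2") auto

lemma odd_residue_cong_iff:
  assumes "i < p" "j < p"
  shows "[2 * int i + 1 = 2 * int j + 1] (mod int p) \<longleftrightarrow> i = j"
proof
  assume "[2 * int i + 1 = 2 * int j + 1] (mod int p)"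
  then have "int p dvd 2 * (int i - int j)"
    by (simp add: cong_iff_dvd_diff algebra_simps)
  moreover have "coprime (int p) 2"
    using p by simp
  ultimately have "[int i = int j] (mod int p)"
    unfolding cong_iff_dvd_diff using coprime_dvd_mult_right_iff by blast
  then show "i = j"
    using assms by (simp add: cong_int_iff cong_less_modulus_unique_nat)
qed auto

text \<open>The excluded index already represents the zero class, since its odd number is
  \<open>p\<close> itself, and distinct indices below \<open>p\<close> give distinct
  classes.\<close>

lemma odd_residue_coprime:
  assumes "j \<in> {..<p} - {(p - 1) div 2}"
  shows "\<not> int p dvd 2 * int j + 1"
proof
  assume "int p dvd 2 * int j + 1"
  moreover have "2 * int ((p - 1) div 2) + 1 = int p"
    using p odd_prime_ge_3 by (auto elim!: oddE)
  ultimately have "[2 * int j + 1 = 2 * int ((p - 1) div 2) + 1] (mod int p)"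
    by (simp add: cong_iff_dvd_diff)
  moreover have half_less: "(p - 1) div 2 < p"
    using odd_prime_ge_3 by simp
  ultimately show False
    using assms odd_residue_cong_iff [of j "(p - 1) div 2"] half_less by simp
qed

lemma fermat_int:
  assumes "\<not> int p dvd a"
  shows "[a ^ (p - 1) = 1] (mod int p)"
proof -
  \<comment> \<open>Replaces \<open>a\<close> by its nonnegative residue, to which Fermat's theorem
    for natural numbers applies.\<close>
  have "[(a mod int p) = a] (mod int p)" by simp
  then have 1: "[int (nat (a mod int p)) ^ (p - 1) = a ^ (p - 1)] (mod int p)"
    using odd_prime_ge_3 by (intro cong_pow) simp
  have "\<not> p dvd nat (a mod int p)"
    using assms odd_prime_ge_3 by (metis dvd_mod_iff int_dvd_int_iff nat_0_le of_nat_0_less_iff 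
      pos_mod_sign dvd_refl p(1) prime_gt_0_nat)
  then have "[nat (a mod int p) ^ (p - 1) = 1] (mod p)"
    using p fermat_theorem by blast
  then have "[int (nat (a mod int p)) ^ (p - 1) = 1] (mod int p)"
    by (metis cong_int_iff of_nat_1 of_nat_power)
  then show ?thesis
    using 1 cong_sym cong_trans by blast
qed

lemma Legendre_minus_one_cong: "[(-1) ^ ((p - 1) div 2) = Legendre (-1) (int p)] (mod int p)"
  using euler_criterion [of p "-1"] p odd_prime_ge_3 by (simp add: cong_sym)

text \<open>The omitted term is a sign times \<open>p ^ n\<close>. It vanishes modulo
  \<open>p\<close> for \<open>n > 0\<close>; for \<open>n = 0\<close> the sign remains, which
  Euler's criterion identifies with the Legendre symbol.\<close>

lemma euler_number_cong_periodic:
  "[euler_number n = periodic_euler p n + (if n = 0 then Legendre (-1) (int p) else 0)] (mod int p)"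
proof -
  let ?h = "(p - 1) div 2"
  have h: "2 * int ?h + 1 = int p" and h': "?h < p"
    using p odd_prime_ge_3 by (auto elim!: oddE)
  have "(\<Sum>j<p. (-1) ^ j * (2 * int j + 1) ^ n) =
      (-1) ^ ?h * (2 * int ?h + 1) ^ n + periodic_euler p n"
    unfolding periodic_euler_def using h' by (intro sum.remove) auto
  then have "(\<Sum>j<p. (-1) ^ j * (2 * int j + 1) ^ n) = periodic_euler p n + (-1) ^ ?h * int p ^ n"
    unfolding h by (simp only: add.commute)
  then have "[euler_number n = periodic_euler p n + (-1) ^ ?h * int p ^ n] (mod int p)"
    using euler_number_cong_power_sum [of p n] p(2) by simp
  also have "[periodic_euler p n + (-1) ^ ?h * int p ^ n =
      periodic_euler p n + (if n = 0 then Legendre (-1) (int p) else 0)] (mod int p)"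
    using Legendre_minus_one_cong by (intro cong_add cong_refl) (simp add: cong_0_iff dvd_power)
  finally show ?thesis .
qed

lemma euler_number_cong_periodic_pos:
  "n > 0 \<Longrightarrow> [euler_number n = periodic_euler p n] (mod int p)"
  using euler_number_cong_periodic [of n] by simp

lemma periodic_euler_periodic:
  "[periodic_euler p (p - 1 + n) = periodic_euler p n] (mod int p)"
  unfolding periodic_euler_def
proof (intro cong_sum)
  fix j assume j: "j \<in> {..<p} - {(p - 1) div 2}"
  have "[(2 * int j + 1) ^ (p - 1) * (2 * int j + 1) ^ n = 1 * (2 * int j + 1) ^ n] (mod int p)"
    by (intro cong_mult cong_refl fermat_int odd_residue_coprime j)
  then show "[(-1) ^ j * (2 * int j + 1) ^ (p - 1 + n) = (-1) ^ j * (2 * int j + 1) ^ n] (mod int p)"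
    unfolding power_add by (intro cong_mult cong_refl) simp
qed

text \<open>Orthogonality over one full period of \<open>p - 1\<close> exponents. If the bases
  agree, \<open>p - 1\<close> equal summands add up to minus one of them; otherwise
  \<open>a - b\<close> times the geometric sum is a difference of two Fermat powers, and
  \<open>a - b\<close> cancels. The bound on \<open>N\<close> keeps \<open>N - k\<close> from
  truncating.\<close>

lemma sum_powers_mult:
  assumes "p - 2 \<le> N" "\<not> int p dvd a" "\<not> int p dvd b"
  shows "[(\<Sum>k\<le>p - 2. a ^ k * b ^ (N - k)) = (if [a = b] (mod int p) then - (a ^ N) else 0)] (mod int p)"
proof (cases "[a = b] (mod int p)")
  case True
  have "[(\<Sum>k\<le>p - 2. a ^ k * b ^ (N - k)) = (\<Sum>k\<le>p - 2. a ^ N)] (mod int p)"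
  proof (intro cong_sum)
    fix k assume "k \<in> {..p - 2}"
    then have "a ^ k * a ^ (N - k) = a ^ N"
      using assms(1) by (simp add: power_add [symmetric])
    moreover have "[a ^ k * b ^ (N - k) = a ^ k * a ^ (N - k)] (mod int p)"
      using True by (intro cong_mult cong_refl cong_pow) (rule cong_sym)
    ultimately show "[a ^ k * b ^ (N - k) = a ^ N] (mod int p)" by simp
  qed
  also have "(\<Sum>k\<le>p - 2. a ^ N) = int p * a ^ N - a ^ N"
    using odd_prime_ge_3 by (simp add: of_nat_diff algebra_simps)
  also have "[int p * a ^ N - a ^ N = - (a ^ N)] (mod int p)"
    by (simp add: cong_iff_dvd_diff)
  finally show ?thesis using True by simp
next
  case False
  have Suc_diff_2: "Suc (p - 2) = p - 1"
    using odd_prime_ge_3 by simp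
  have "(a - b) * (\<Sum>k\<le>p - 2. a ^ k * b ^ (p - 2 - k)) = a ^ (p - 1) - b ^ (p - 1)"
    using diff_power_eq_sum [of a "p - 2" b] odd_prime_ge_3
    by (simp only: lessThan_Suc_atMost Suc_diff_2 [symmetric])
  moreover have "[a ^ (p - 1) - b ^ (p - 1) = 1 - 1] (mod int p)"
    using assms by (intro cong_diff fermat_int)
  ultimately have "int p dvd (a - b) * (\<Sum>k\<le>p - 2. a ^ k * b ^ (p - 2 - k))"
    by (simp add: cong_0_iff)
  then have "int p dvd (\<Sum>k\<le>p - 2. a ^ k * b ^ (p - 2 - k))"
    using False p(1) by (simp add: cong_iff_dvd_diff prime_dvd_mult_iff)
  \<comment> \<open>The extra power of \<open>b\<close> raises the exponents from
    \<open>p - 2 - k\<close> to \<open>N - k\<close>.\<close>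
  then have "int p dvd (\<Sum>k\<le>p - 2. a ^ k * b ^ (p - 2 - k)) * b ^ (N - (p - 2))"
    by simp
  also have "\<dots> = (\<Sum>k\<le>p - 2. a ^ k * b ^ (N - k))"
    unfolding sum_distrib_right mult.assoc power_add [symmetric]
  proof (intro sum.cong refl)
    fix k assume "k \<in> {..p - 2}"
    then have "p - 2 - k + (N - (p - 2)) = N - k"
      using assms(1) by auto
    then show "a ^ k * b ^ (p - 2 - k + (N - (p - 2))) = a ^ k * b ^ (N - k)"
      by (simp only:)
  qed
  finally show ?thesis using False by (simp add: cong_0_iff)
qed

text \<open>If \<open>p - 1\<close> divides \<open>n\<close>, all \<open>p - 1\<close> summands are
  1 by Fermat. Otherwise a primitive root \<open>g\<close> turns the sum into a geometric one whose
  ratio \<open>g ^ n\<close> is not 1 modulo \<open>p\<close> but has \<open>(p - 1)\<close>-th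
  power 1.\<close>

lemma sum_totatives_power:
  "[(\<Sum>t\<in>totatives p. int t ^ n) = (if p - 1 dvd n then -1 else 0)] (mod int p)"
proof (cases "p - 1 dvd n")
  case True
  then obtain d where d: "n = (p - 1) * d" ..
  have "[(\<Sum>t\<in>totatives p. int t ^ n) = (\<Sum>t\<in>totatives p. 1)] (mod int p)"
  proof (rule cong_sum)
    fix t assume "t \<in> totatives p"
    then have "\<not> int p dvd int t"
      using p(1) by (auto simp: totatives_prime dest: nat_dvd_not_less)
    then have "[(int t ^ (p - 1)) ^ d = 1 ^ d] (mod int p)"
      by (intro cong_pow fermat_int)
    then show "[int t ^ n = 1] (mod int p)"
      by (simp add: d power_mult)
  qed
  also have "(\<Sum>t\<in>totatives p. 1) = int p - 1"
    using p(1) odd_prime_ge_3 by (simp add: totatives_prime of_nat_diff)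
  also have "[int p - 1 = -1] (mod int p)"
    by (simp add: cong_iff_dvd_diff)
  finally show ?thesis using True by simp
next
  case False
  obtain g where g: "residue_primroot p g"
    using prime_primitive_root_exists [of p] p(1) prime_gt_1_nat by blast
  have ord: "ord p g = p - 1"
    using g p(1) by (simp add: residue_primroot_def totient_prime)
  have "(\<Sum>t\<in>totatives p. int t ^ n) = (\<Sum>i<p - 1. int (g ^ i mod p) ^ n)"
    using sum.reindex_bij_betw [OF residue_primroot_is_generator [OF _ g], of "\<lambda>t. int t ^ n"]
      prime_gt_1_nat [OF p(1)] p(1) by (simp add: totient_prime)
  also have "[\<dots> = (\<Sum>i<p - 1. (int g ^ n) ^ i)] (mod int p)"
  proof (rule cong_sum)
    fix i
    have "[int (g ^ i mod p) ^ n = (int g ^ i) ^ n] (mod int p)"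
      by (intro cong_pow) (simp add: zmod_int)
    then show "[int (g ^ i mod p) ^ n = (int g ^ n) ^ i] (mod int p)"
      by (simp add: power_mult [symmetric] mult.commute)
  qed
  also have "[(\<Sum>i<p - 1. (int g ^ n) ^ i) = 0] (mod int p)"
  proof -
    have "[g ^ (n * (p - 1)) = 1] (mod p)"
      by (simp add: ord_divides' ord)
    then have "[(int g ^ n) ^ (p - 1) = 1] (mod int p)"
      using cong_int_iff [of "g ^ (n * (p - 1))" 1 p] by (simp add: power_mult)
    then have "int p dvd (int g ^ n - 1) * (\<Sum>i<p - 1. (int g ^ n) ^ i)"
      by (simp add: cong_iff_dvd_diff power_diff_1_eq [symmetric])
    moreover have "\<not> [g ^ n = 1] (mod p)"
      using False by (simp add: ord_divides' ord)
    then have "\<not> int p dvd int g ^ n - 1"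
      using cong_int_iff [of "g ^ n" 1 p] by (simp add: cong_iff_dvd_diff)
    ultimately show ?thesis
      using p(1) by (simp add: prime_dvd_mult_iff cong_0_iff)
  qed
  finally show ?thesis using False by simp
qed

text \<open>An injection between sets of the same size \<open>p - 1\<close> is a bijection.\<close>

lemma bij_betw_odd_residues:
  "bij_betw (\<lambda>j. (2 * j + 1) mod p) ({..<p} - {(p - 1) div 2}) (totatives p)"
proof -
  let ?J = "{..<p} - {(p - 1) div 2}" and ?f = "\<lambda>j. (2 * j + 1) mod p"
  have inj: "inj_on ?f ?J"
  proof (rule inj_onI)
    fix i j assume ij: "i \<in> ?J" "j \<in> ?J" and "?f i = ?f j"
    then have "[int (2 * i + 1) = int (2 * j + 1)] (mod int p)"
      unfolding cong_int_iff by (simp add: cong_def)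
    then show "i = j"
      using ij odd_residue_cong_iff [of i j] by (simp add: add.commute)
  qed
  have sub: "?f ` ?J \<subseteq> totatives p"
  proof
    fix t assume "t \<in> ?f ` ?J"
    then obtain j where j: "j \<in> ?J" "t = ?f j" by blast
    have "\<not> p dvd 2 * j + 1"
      using odd_residue_coprime [OF j(1)] int_dvd_int_iff [of p "2 * j + 1"]
      by (simp add: add.commute)
    then show "t \<in> totatives p"
      using j(2) p(1) prime_gt_0_nat by (simp add: totatives_prime dvd_eq_mod_eq_0)
  qed
  have "card (?f ` ?J) = card ?J"
    using inj by (rule card_image)
  also have "\<dots> = card (totatives p)"
    using p(1) odd_prime_ge_3 by (simp add: totatives_prime)
  finally show ?thesis
    using inj sub by (simp add: bij_betw_def card_subset_eq)
qed

lemma sum_odd_residue_powers: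
  "[(\<Sum>j\<in>{..<p} - {(p - 1) div 2}. (2 * int j + 1) ^ n) = (if p - 1 dvd n then -1 else 0)] (mod int p)"
proof -
  let ?J = "{..<p} - {(p - 1) div 2}"
  have "[(\<Sum>j\<in>?J. (2 * int j + 1) ^ n) = (\<Sum>j\<in>?J. int ((2 * j + 1) mod p) ^ n)] (mod int p)"
  proof (intro cong_sum cong_pow)
    show "[2 * int j + 1 = int ((2 * j + 1) mod p)] (mod int p)" for j
      by (simp add: zmod_int add.commute)
  qed
  also have "(\<Sum>j\<in>?J. int ((2 * j + 1) mod p) ^ n) = (\<Sum>t\<in>totatives p. int t ^ n)"
    by (rule sum.reindex_bij_betw [OF bij_betw_odd_residues])
  finally show ?thesis
    using sum_totatives_power cong_trans by blast
qed

text \<open>Expanding both factors gives a double sum over \<open>i\<close> and \<open>j\<close>.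
  Orthogonality kills the terms with \<open>i \<noteq> j\<close>; on the diagonal the signs square
  to 1, leaving minus a power sum over all nonzero residues.\<close>

lemma periodic_euler_convolution:
  assumes "p - 2 \<le> N"
  shows "[(\<Sum>k\<le>p - 2. periodic_euler p k * periodic_euler p (N - k)) =
    (if p - 1 dvd N then 1 else 0)] (mod int p)"
proof -
  let ?J = "{..<p} - {(p - 1) div 2}"
  let ?a = "\<lambda>j. 2 * int j + 1"
  let ?F = "\<lambda>i j. (-1) ^ i * (-1) ^ j * (\<Sum>k\<le>p - 2. ?a i ^ k * ?a j ^ (N - k))"
  have "(\<Sum>k\<le>p - 2. periodic_euler p k * periodic_euler p (N - k)) =
      (\<Sum>k\<le>p - 2. \<Sum>i\<in>?J. \<Sum>j\<in>?J. (-1) ^ i * (-1) ^ j * (?a i ^ k * ?a j ^ (N - k)))"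
    by (simp add: periodic_euler_def sum_product mult_ac)
  also have "\<dots> = (\<Sum>i\<in>?J. \<Sum>k\<le>p - 2. \<Sum>j\<in>?J. (-1) ^ i * (-1) ^ j * (?a i ^ k * ?a j ^ (N - k)))"
    by (rule sum.swap)
  also have "\<dots> = (\<Sum>i\<in>?J. \<Sum>j\<in>?J. ?F i j)"
    unfolding sum_distrib_left by (intro sum.cong refl sum.swap)
  finally have expand: "(\<Sum>k\<le>p - 2. periodic_euler p k * periodic_euler p (N - k)) =
      (\<Sum>i\<in>?J. \<Sum>j\<in>?J. ?F i j)" .
  have diag: "[(\<Sum>j\<in>?J. ?F i j) = - (?a i ^ N)] (mod int p)" if i: "i \<in> ?J" for i
  proof -
    have "[(\<Sum>j\<in>?J. ?F i j) = (\<Sum>j\<in>?J. if i = j then - (?a i ^ N) else 0)] (mod int p)"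
    proof (rule cong_sum)
      fix j assume j: "j \<in> ?J"
      have "[?F i j = (-1) ^ i * (-1) ^ j *
          (if [?a i = ?a j] (mod int p) then - (?a i ^ N) else 0)] (mod int p)"
        by (intro cong_mult cong_refl sum_powers_mult assms odd_residue_coprime i j)
      moreover have "(-1) ^ i * (-1) ^ j *
          (if [?a i = ?a j] (mod int p) then - (?a i ^ N) else 0) =
          (if i = j then - (?a i ^ N) else 0)"
        using i j odd_residue_cong_iff [of i j] by (simp add: power_add [symmetric])
      ultimately show "[?F i j = (if i = j then - (?a i ^ N) else 0)] (mod int p)"
        by (simp only:)
    qed
    then show ?thesis using i by simp
  qed
  have "[(\<Sum>i\<in>?J. \<Sum>j\<in>?J. ?F i j) = (\<Sum>i\<in>?J. - (?a i ^ N))] (mod int p)"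
    by (rule cong_sum) (rule diag)
  moreover have "[(\<Sum>i\<in>?J. - (?a i ^ N)) = - (if p - 1 dvd N then -1 else 0)] (mod int p)"
    unfolding sum_negf cong_minus_minus_iff by (rule sum_odd_residue_powers)
  ultimately have "[(\<Sum>i\<in>?J. \<Sum>j\<in>?J. ?F i j) = - (if p - 1 dvd N then -1 else 0)] (mod int p)"
    by (rule cong_trans)
  then show ?thesis
    unfolding expand by (simp split: if_splits)
qed

section \<open>Convolution sums of Euler numbers\<close>

text \<open>For \<open>p > 3\<close> the indices up to \<open>p - 3\<close> lack only
  \<open>k = p - 2\<close> for a full period, and the periodic part vanishes at that odd index. As
  \<open>p - 1\<close> does not divide \<open>p - 3\<close>, the periodic convolution is 0, and the
  right side comes from correcting the Euler number at 0, once at each end.\<close>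

lemma euler_convolution_low:
  "[(\<Sum>k\<le>p - 3. euler_number k * euler_number (p - 3 - k)) =
      2 * Legendre (-1) (int p) * euler_number (p - 3)] (mod int p)"
\<comment> \<open>For \<open>p = 3\<close> both ends are the same summand, so the two sides 1 and -2
  are compared directly.\<close>
proof (cases "p = 3")
  case True
  have "[2 * Legendre (-1) (int p) = 2 * (-1)] (mod int p)"
    using Legendre_minus_one_cong True by (intro cong_mult cong_refl) (simp add: cong_sym)
  also have "[2 * (-1) = 1] (mod int p)"
    by (simp add: True cong_def)
  finally show ?thesis
    using True by (simp add: euler_number_0 cong_sym)
next
  case False
  define m where "m = p - 3"
  define \<chi> where "\<chi> = Legendre (-1) (int p)"
  let ?e = "periodic_euler p"
  have m: "m > 0" "p = m + 3"
    using False odd_prime_ge_3 by (auto simp: m_def)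
  have "[?e (Suc m) = euler_number (Suc m)] (mod int p)"
    by (rule cong_sym, rule euler_number_cong_periodic_pos) simp
  also have "euler_number (Suc m) = 0"
    using p(2) m by (intro euler_number_odd) auto
  finally have e0: "[?e (Suc m) = 0] (mod int p)" .
  \<comment> \<open>The product with 0 stands for the missing summand \<open>k = p - 2\<close>.
    Shifting \<open>m\<close> by one period to \<open>2 * m + 2\<close> keeps \<open>N - k\<close>
    untruncated over the full period.\<close>
  have "[(\<Sum>k\<le>m. ?e k * ?e (m - k)) + 0 * ?e (Suc m) =
      (\<Sum>k\<le>m. ?e k * ?e (2 * m + 2 - k)) + ?e (Suc m) * ?e (Suc m)] (mod int p)"
  proof (intro cong_add cong_sum cong_mult cong_refl)
    fix k assume "k \<in> {..m}"
    then have "p - 1 + (m - k) = 2 * m + 2 - k"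
      using m by simp
    then show "[?e (m - k) = ?e (2 * m + 2 - k)] (mod int p)"
      using periodic_euler_periodic [of "m - k"] by (simp add: cong_sym)
  qed (rule cong_sym [OF e0])
  also have "(\<Sum>k\<le>m. ?e k * ?e (2 * m + 2 - k)) + ?e (Suc m) * ?e (Suc m) =
      (\<Sum>k\<le>p - 2. ?e k * ?e (2 * m + 2 - k))"
    using m by simp
  also have "[\<dots> = (if p - 1 dvd 2 * m + 2 then 1 else 0)] (mod int p)"
    using m by (intro periodic_euler_convolution) simp
  also have "p - 1 dvd 2 * m + 2 \<longleftrightarrow> False"
  proof (intro iffI)
    assume "p - 1 dvd 2 * m + 2"
    moreover have "2 * m + 2 = (p - 1) + m"
      using m by simp
    ultimately have "p - 1 dvd m"
      by (metis dvd_add_triv_left_iff)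
    then show False
      using m by (auto dest: dvd_imp_le)
  qed simp
  finally have conv: "[(\<Sum>k\<le>m. ?e k * ?e (m - k)) = 0] (mod int p)" by simp
  have "[(\<Sum>k\<le>m. euler_number k * euler_number (m - k)) =
      (\<Sum>k\<le>m. (?e k + (if k = 0 then \<chi> else 0)) * (?e (m - k) + (if m - k = 0 then \<chi> else 0)))] (mod int p)"
    unfolding \<chi>_def by (intro cong_sum cong_mult euler_number_cong_periodic)
  \<comment> \<open>Since \<open>m > 0\<close>, the two corrections never meet in one summand, so
    \<open>\<chi> * \<chi>\<close> does not occur.\<close>
  also have "(\<Sum>k\<le>m. (?e k + (if k = 0 then \<chi> else 0)) * (?e (m - k) + (if m - k = 0 then \<chi> else 0))) =
      (\<Sum>k\<le>m. ?e k * ?e (m - k) + (if k = 0 then \<chi> * ?e m else 0) +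
      (if k = m then \<chi> * ?e m else 0))"
    using m by (intro sum.cong) (auto simp: algebra_simps)
  also have "\<dots> = (\<Sum>k\<le>m. ?e k * ?e (m - k)) + 2 * \<chi> * ?e m"
    by (simp add: sum.distrib)
  also have "[\<dots> = 0 + 2 * \<chi> * euler_number m] (mod int p)"
    using m by (intro cong_add conv cong_mult cong_refl cong_sym [OF euler_number_cong_periodic_pos])
  finally show ?thesis
    by (simp add: m_def \<chi>_def)
qed

text \<open>Summands with odd \<open>k\<close> vanish, so restricting to even indices loses
  nothing.\<close>

lemma euler_s_eq: "euler_s n = (\<Sum>k\<le>2 * n. euler_number k * euler_number (2 * n - k))"
proof -
  have "(\<Sum>k\<le>2 * n. euler_number k * euler_number (2 * n - k)) =
      (\<Sum>k\<in>(*) 2 ` {0..n}. euler_number k * euler_number (2 * n - k))"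
  proof (rule sum.mono_neutral_right)
    show "\<forall>k\<in>{..2 * n} - (*) 2 ` {0..n}. euler_number k * euler_number (2 * n - k) = 0"
    proof
      fix k assume "k \<in> {..2 * n} - (*) 2 ` {0..n}"
      then have "odd k" by (auto elim!: evenE)
      then show "euler_number k * euler_number (2 * n - k) = 0"
        by (simp add: euler_number_odd)
    qed
  qed auto
  also have "\<dots> = euler_s n"
    unfolding euler_s_def by (subst sum.reindex) (auto simp: inj_on_def)
  finally show ?thesis ..
qed

text \<open>The first \<open>p - 1\<close> summands form a full period and yield the indicator plus
  a correction at \<open>k = 0\<close>. The rest, shifted back by one period, yield
  \<open>euler_s n\<close> minus a similar correction. The corrections cancel for
  \<open>n > 0\<close> and leave -1 for \<open>n = 0\<close>.\<close>

lemma euler_convolution_high: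
  "[(\<Sum>k\<le>p - 1 + 2 * n. euler_number k * euler_number (p - 1 + 2 * n - k)) =
      euler_s n + euler_delta p n] (mod int p)"
proof -
  define N where "N = p - 1 + 2 * n"
  define \<chi> where "\<chi> = Legendre (-1) (int p)"
  let ?e = "periodic_euler p" and ?E = euler_number
  have p2: "N = (p - 2) + Suc (2 * n)" "Suc (p - 2) = p - 1"
    using odd_prime_ge_3 by (auto simp: N_def)
  have split: "(\<Sum>k\<le>N. ?E k * ?E (N - k)) =
      (\<Sum>k\<le>p - 2. ?E k * ?E (N - k)) + (\<Sum>i\<le>2 * n. ?E (p - 1 + i) * ?E (2 * n - i))"
  proof -
    have "(\<Sum>k\<le>N. ?E k * ?E (N - k)) =
        (\<Sum>k\<le>p - 2. ?E k * ?E (N - k)) + (\<Sum>k=p - 1..p - 1 + 2 * n. ?E k * ?E (N - k))"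
      using sum_up_index_split [of "\<lambda>k. ?E k * ?E (N - k)" "p - 2" "Suc (2 * n)"]
      unfolding p2(1) [symmetric] p2(2) N_def .
    also have "(\<Sum>k=p - 1..p - 1 + 2 * n. ?E k * ?E (N - k)) =
        (\<Sum>i\<le>2 * n. ?E (p - 1 + i) * ?E (2 * n - i))"
      by (rule sum.reindex_bij_witness [of _ "\<lambda>i. p - 1 + i" "\<lambda>k. k - (p - 1)"])
        (auto simp: N_def add.commute add.left_commute)
    finally show ?thesis .
  qed
  have eN: "[?e N = ?e (2 * n)] (mod int p)"
    unfolding N_def by (rule periodic_euler_periodic)
  \<comment> \<open>Here \<open>N - k\<close> is at least 1, so only the first factor needs the
    correction at 0.\<close>
  have "[(\<Sum>k\<le>p - 2. ?E k * ?E (N - k)) =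
      (\<Sum>k\<le>p - 2. (?e k + (if k = 0 then \<chi> else 0)) * ?e (N - k))] (mod int p)"
    unfolding \<chi>_def using p2
    by (intro cong_sum cong_mult euler_number_cong_periodic euler_number_cong_periodic_pos) auto
  also have "(\<Sum>k\<le>p - 2. (?e k + (if k = 0 then \<chi> else 0)) * ?e (N - k)) =
      (\<Sum>k\<le>p - 2. ?e k * ?e (N - k) + (if k = 0 then \<chi> * ?e N else 0))"
    by (intro sum.cong) (auto simp: algebra_simps)
  also have "\<dots> = (\<Sum>k\<le>p - 2. ?e k * ?e (N - k)) + \<chi> * ?e N"
    by (simp add: sum.distrib)
  also have "[\<dots> = (if p - 1 dvd N then 1 else 0) + \<chi> * ?e (2 * n)] (mod int p)"
    using p2 by (intro cong_add cong_mult cong_refl eN periodic_euler_convolution) simp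
  finally have low: "[(\<Sum>k\<le>p - 2. ?E k * ?E (N - k)) =
      (if p - 1 dvd N then 1 else 0) + \<chi> * ?e (2 * n)] (mod int p)" .
  have "[(\<Sum>i\<le>2 * n. ?E (p - 1 + i) * ?E (2 * n - i)) =
      (\<Sum>i\<le>2 * n. (?E i - (if i = 0 then \<chi> else 0)) * ?E (2 * n - i))] (mod int p)"
  proof (intro cong_sum cong_mult cong_refl)
    fix i
    have "[?E (p - 1 + i) = ?e (p - 1 + i)] (mod int p)"
      using odd_prime_ge_3 by (intro euler_number_cong_periodic_pos) simp
    also have "[?e (p - 1 + i) = ?e i] (mod int p)"
      by (rule periodic_euler_periodic)
    also have "[?e i = ?E i - (if i = 0 then \<chi> else 0)] (mod int p)"
      using cong_diff [OF cong_sym [OF euler_number_cong_periodic [of i]] cong_refl,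
          of "if i = 0 then \<chi> else 0"]
      unfolding \<chi>_def by simp
    finally show "[?E (p - 1 + i) = ?E i - (if i = 0 then \<chi> else 0)] (mod int p)" .
  qed
  also have "(\<Sum>i\<le>2 * n. (?E i - (if i = 0 then \<chi> else 0)) * ?E (2 * n - i)) =
      (\<Sum>i\<le>2 * n. ?E i * ?E (2 * n - i) - (if i = 0 then \<chi> * ?E (2 * n) else 0))"
    by (intro sum.cong) (auto simp: algebra_simps)
  also have "\<dots> = euler_s n - \<chi> * ?E (2 * n)"
    by (simp add: sum_subtractf euler_s_eq)
  finally have high: "[(\<Sum>i\<le>2 * n. ?E (p - 1 + i) * ?E (2 * n - i)) =
      euler_s n - \<chi> * ?E (2 * n)] (mod int p)" .
  have "[\<chi> * ?e (2 * n) - \<chi> * ?E (2 * n) = - (if n = 0 then \<chi> * \<chi> else 0)] (mod int p)"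
  proof -
    have "[\<chi> * ?E (2 * n) = \<chi> * (?e (2 * n) + (if n = 0 then \<chi> else 0))] (mod int p)"
      using euler_number_cong_periodic [of "2 * n"] unfolding \<chi>_def
      by (intro cong_mult cong_refl) simp
    from cong_diff [OF cong_refl this, of "\<chi> * ?e (2 * n)"] show ?thesis
      by (simp add: algebra_simps split: if_splits)
  qed
  moreover have "\<chi> * \<chi> = 1"
  proof -
    \<comment> \<open>Rules out the value 0 of the Legendre symbol, leaving 1 and -1.\<close>
    have "\<not> [-1 = 0] (mod int p)"
      using odd_prime_ge_3 by (auto simp: cong_0_iff)
    then show ?thesis by (simp add: \<chi>_def Legendre_def)
  qed
  ultimately have corr: "[\<chi> * ?e (2 * n) - \<chi> * ?E (2 * n) = - (if n = 0 then 1 else 0)] (mod int p)"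
    by (cases "n = 0") simp_all
  have "[(\<Sum>k\<le>N. ?E k * ?E (N - k)) =
      ((if p - 1 dvd N then 1 else 0) + \<chi> * ?e (2 * n)) + (euler_s n - \<chi> * ?E (2 * n))] (mod int p)"
    unfolding split by (rule cong_add [OF low high])
  also have "((if p - 1 dvd N then 1 else 0) + \<chi> * ?e (2 * n)) + (euler_s n - \<chi> * ?E (2 * n)) =
      euler_s n + (if p - 1 dvd N then 1 else 0) + (\<chi> * ?e (2 * n) - \<chi> * ?E (2 * n))"
    by (simp add: algebra_simps)
  also have "[\<dots> = euler_s n + (if p - 1 dvd N then 1 else 0) + - (if n = 0 then 1 else 0)] (mod int p)"
    by (rule cong_add [OF cong_refl corr])
  \<comment> \<open>\<open>p - 1\<close> divides \<open>N\<close> exactly when it divides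
    \<open>2 * n\<close>; at \<open>n = 0\<close> the indicator is 1 and the leftover -1 cancels it,
    whence the condition \<open>n > 0\<close> in \<open>euler_delta\<close>.\<close>
  also have "euler_s n + (if p - 1 dvd N then 1 else 0) + - (if n = 0 then 1 else 0) =
      euler_s n + euler_delta p n"
    unfolding N_def euler_delta_def by auto
  finally show ?thesis
    unfolding N_def .
qed

end

theorem theorem1p1:
  fixes p :: nat
  assumes "prime p" and "odd p"
  shows "[(\<Sum>k=0..p - 3. euler_number k * euler_number (p - 3 - k)) =
            2 * Legendre (-1) (int p) * euler_number (p - 3)] (mod int p)
         \<and> (\<forall>n::nat.
              [(\<Sum>k=0..p - 1 + 2 * n. euler_number k * euler_number (p - 1 + 2 * n - k)) =
                 euler_s n + euler_delta p n] (mod int p))"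
  using euler_convolution_low [OF assms] euler_convolution_high [OF assms]
  by (simp add: atMost_atLeast0)

end
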